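(* For every integer $k\geq 0$ there are infinitely many $n$ such that every stable probabilistic OBDD on $n$ variables computing $\mathtt{PartialMOD^k_n}$ with bounded error has width at least $2^{k+1}$.
   Context: For $\nu\in\{0,1\}^n$ let $\#_1(\nu)$ be the number of ones in $\nu$. The partial function $\mathtt{PartialMOD^k_n}$ on $\{0,1\}^n$ is defined by $\mathtt{PartialMOD^k_n}(\nu)=1$ if $\#_1(\nu)\equiv 0 \pmod{2^{k+1}}$, $\mathtt{PartialMOD^k_n}(\nu)=0$ if $\#_1(\nu)\equiv 2^k \pmod{2^{k+1}}$, and undefined otherwise. A probabilistic OBDD of width $d$ on $\{0,1\}^n$ is a tuple $(T,v^0,Accept,\pi)$ where $T=\{(A_j(0),A_j(1)):1\le j\le n\}$ are pairs of $d\times d$ (column-)stochastic matrices, $v^0$ is a $0$-$1$ stochastic vector in $\mathbb{R}^d$, $Accept\subseteq\{1,\dots,d\}$, and $\pi$ is a permutation of $\{1,\dots,n\}$. On input $\nu$, set $v^j=A_j(\nu_{\pi(j)})v^{j-1}$ for $j=1,\dots,n$; the acceptance probability is $\sum_{i\in Accept}v^n_i$. It is stable if $A_j(0)$ and $A_j(1)$ do not depend on $j$. It computes a partial function $f$ with bounded error if there is $\varepsilon\in(0,1/2]$ such that every $\nu$ with $f(\nu)=1$ is accepted with probability at least $1/2+\varepsilon$ and every $\nu$ with $f(\nu)=0$ is accepted with probability at most $1/2-\varepsilon$.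
   Formalization: The error margin ε in (0,1/2] is fixed before n: for every k and ε there are infinitely many n (which may depend on ε) with the stated width bound. If ε may depend on the OBDD, as in the given definition, the claim is false: for k=1 width 3 suffices for every n. *)

theory Defs
  imports
    "HOL-Number_Theory.Cong"
    "HOL-Combinatorics.Permutations"
    "Jordan_Normal_Form.Matrix"
begin

text \<open>
  Inputs in \<open>{0,1}\<^sup>n\<close> are Boolean lists of length \<open>n\<close>. Variables, levels and states are
  numbered from 0, so \<open>trans P j b\<close> is the matrix \<open>A\<^sub>j\<^sub>+\<^sub>1(b)\<close>.
\<close>

definition num_ones :: "bool list \<Rightarrow> nat" where
  "num_ones \<nu> = card {i. i < length \<nu> \<and> \<nu> ! i}"

definition PartialMOD :: "nat \<Rightarrow> nat \<Rightarrow> bool list \<Rightarrow> bool option" where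
  "PartialMOD k n \<nu> =
     (if length \<nu> \<noteq> n then None
      else if [num_ones \<nu> = 0] (mod 2 ^ (k + 1)) then Some True
      else if [num_ones \<nu> = 2 ^ k] (mod 2 ^ (k + 1)) then Some False
      else None)"

definition column_stochastic :: "nat \<Rightarrow> real mat \<Rightarrow> bool" where
  "column_stochastic d A \<longleftrightarrow>
     A \<in> carrier_mat d d \<and>
     (\<forall>i<d. \<forall>j<d. 0 \<le> A $$ (i, j)) \<and>
     (\<forall>j<d. (\<Sum>i<d. A $$ (i, j)) = 1)"

definition stochastic_vec :: "nat \<Rightarrow> real vec \<Rightarrow> bool" where
  "stochastic_vec d v \<longleftrightarrow>
     v \<in> carrier_vec d \<and> (\<forall>i<d. 0 \<le> v $ i) \<and> (\<Sum>i<d. v $ i) = 1"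

record pobdd =
  trans :: "nat \<Rightarrow> bool \<Rightarrow> real mat"
  init :: "real vec"
  accept :: "nat set"
  perm :: "nat \<Rightarrow> nat"

definition is_pobdd :: "nat \<Rightarrow> nat \<Rightarrow> pobdd \<Rightarrow> bool" where
  "is_pobdd n d P \<longleftrightarrow>
     (\<forall>j<n. \<forall>b. column_stochastic d (trans P j b)) \<and>
     stochastic_vec d (init P) \<and> (\<forall>i<d. init P $ i \<in> {0, 1}) \<and>
     accept P \<subseteq> {..<d} \<and>
     perm P permutes {..<n}"

definition stable_pobdd :: "nat \<Rightarrow> pobdd \<Rightarrow> bool" where
  "stable_pobdd n P \<longleftrightarrow> (\<forall>i<n. \<forall>j<n. \<forall>b. trans P i b = trans P j b)"

primrec state :: "pobdd \<Rightarrow> bool list \<Rightarrow> nat \<Rightarrow> real vec" where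
  "state P \<nu> 0 = init P"
| "state P \<nu> (Suc j) = trans P j (\<nu> ! perm P j) *\<^sub>v state P \<nu> j"

definition accept_prob :: "pobdd \<Rightarrow> bool list \<Rightarrow> real" where
  "accept_prob P \<nu> = (\<Sum>i\<in>accept P. state P \<nu> (length \<nu>) $ i)"

text \<open>
  Bounded error with an explicit margin \<open>\<epsilon>\<close>. The margin is a parameter because it has to be
  uniform in \<open>n\<close>. If it may depend on the OBDD at each \<open>n\<close>, then width 3 suffices for \<open>k = 1\<close> and
  every \<open>n\<close>: let reading 0 do nothing, let reading 1 move along the cycle 0, 1, 2 with holding
  probabilities 3/5, 1/5, 1/5, and start in and accept at state 0. After \<open>2 * l\<close> ones the
  acceptance probability is \<open>1/2 + (1/2) * (-7/25) ^ l\<close>.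
\<close>

definition computes_bounded_error ::
  "real \<Rightarrow> nat \<Rightarrow> pobdd \<Rightarrow> (bool list \<Rightarrow> bool option) \<Rightarrow> bool" where
  "computes_bounded_error \<epsilon> n P f \<longleftrightarrow>
     (\<forall>\<nu>. length \<nu> = n \<longrightarrow>
        (f \<nu> = Some True \<longrightarrow> 1/2 + \<epsilon> \<le> accept_prob P \<nu>) \<and>
        (f \<nu> = Some False \<longrightarrow> accept_prob P \<nu> \<le> 1/2 - \<epsilon>))"

end

theory Submission
  imports Defs Complex_Main
begin

text \<open>
  Let \<open>D = 2\<^sup>k c\<close> with \<open>c\<close> odd be a multiple of all positive integers below \<open>2\<^sup>k\<^sup>+\<^sup>1\<close>.  For a
  stochastic matrix \<open>A\<close> of size \<open>d < 2\<^sup>k\<^sup>+\<^sup>1\<close>, every state on a cycle lies on one of length at most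
  \<open>d\<close>, which divides \<open>D\<close>, so \<open>A\<^sup>D\<close> has no periodicity and \<open>A\<^sup>t - A\<^sup>t\<^sup>+\<^sup>D\<close> tends to 0.  Its column norms
  are nonincreasing in \<open>t\<close> and the stochastic matrices form a compact set, so the convergence is
  uniform in \<open>A\<close>.  Let the OBDD read first \<open>m\<close> ones and then \<open>n - m\<close> zeros: for large \<open>n\<close>, replacing
  \<open>m = D T\<close> by \<open>m + D\<close> changes both the power of \<open>A(1)\<close> and that of \<open>A(0)\<close> by a negligible amount, and
  so changes the acceptance probability by at most \<open>\<epsilon>\<close>, although it flips the value of the function.
\<close>

section \<open>Powers of stochastic kernels and the lag distance\<close>

text \<open>Matrices are plain functions of two indices, of which only the values below
  \<open>d\<close> matter. This makes entrywise limits of sequences of matrices easy to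
  state.\<close>

primrec kpow :: "nat \<Rightarrow> (nat \<Rightarrow> nat \<Rightarrow> real) \<Rightarrow> nat \<Rightarrow> nat \<Rightarrow> nat \<Rightarrow> real" where
  "kpow d A 0 = (\<lambda>i j. of_bool (i = j))"
| "kpow d A (Suc t) = (\<lambda>i j. \<Sum>l<d. A i l * kpow d A t l j)"

text \<open>For a stochastic kernel this is twice the total variation distance between the laws at
  times \<open>t\<close> and \<open>t + D\<close> of the chain started in \<open>j\<close>.\<close>

definition lag_dist :: "nat \<Rightarrow> (nat \<Rightarrow> nat \<Rightarrow> real) \<Rightarrow> nat \<Rightarrow> nat \<Rightarrow> nat \<Rightarrow> real" where
  "lag_dist d A D t j = (\<Sum>i<d. \<bar>kpow d A t i j - kpow d A (t + D) i j\<bar>)"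

lemma kpow_add:
  assumes "i < d" "j < d"
  shows "kpow d A (s + t) i j = (\<Sum>l<d. kpow d A s i l * kpow d A t l j)"
  using assms(1)
proof (induction s arbitrary: i)
  case 0
  have "(\<Sum>l<d. of_bool (i = l) * kpow d A t l j) = (\<Sum>l<d. if i = l then kpow d A t l j else 0)"
    by (rule sum.cong) auto
  then show ?case using 0 by simp
next
  case (Suc s)
  have "kpow d A (Suc s + t) i j = (\<Sum>l<d. A i l * (\<Sum>m<d. kpow d A s l m * kpow d A t m j))"
    using Suc.IH by simp
  also have "\<dots> = (\<Sum>l<d. \<Sum>m<d. A i l * kpow d A s l m * kpow d A t m j)"
    by (simp add: sum_distrib_left mult.assoc)
  also have "\<dots> = (\<Sum>m<d. \<Sum>l<d. A i l * kpow d A s l m * kpow d A t m j)"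
    by (rule sum.swap)
  finally show ?case by (simp add: sum_distrib_right)
qed

lemma kpow_1: "i < d \<Longrightarrow> j < d \<Longrightarrow> kpow d A (Suc 0) i j = A i j"
  using sum.delta[of "{..<d}" j "A i"] by (simp add: of_bool_def if_distrib[of "(*) _"] cong: if_cong)

locale stochastic_kernel =
  fixes d :: nat and A :: "nat \<Rightarrow> nat \<Rightarrow> real"
  assumes nonneg: "i < d \<Longrightarrow> j < d \<Longrightarrow> 0 \<le> A i j"
    and column_sum: "j < d \<Longrightarrow> (\<Sum>i<d. A i j) = 1"
begin

abbreviation P where "P \<equiv> kpow d A"

lemma kpow_nonneg: "i < d \<Longrightarrow> j < d \<Longrightarrow> 0 \<le> P t i j"
  by (induction t arbitrary: i) (auto intro!: sum_nonneg mult_nonneg_nonneg nonneg)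

lemma kpow_column_sum: "j < d \<Longrightarrow> (\<Sum>i<d. P t i j) = 1"
proof (induction t)
  case 0
  have "(\<Sum>i<d. P 0 i j) = (\<Sum>i<d. if i = j then 1 else 0)"
    by (rule sum.cong) auto
  then show ?case using 0 by simp
next
  case (Suc t)
  have "(\<Sum>i<d. P (Suc t) i j) = (\<Sum>l<d. \<Sum>i<d. A i l * P t l j)"
    unfolding kpow.simps by (rule sum.swap)
  also have "\<dots> = (\<Sum>l<d. P t l j)"
    by (simp add: sum_distrib_right[symmetric] column_sum)
  finally show ?case using Suc by simp
qed

lemma kpow_le_1: "i < d \<Longrightarrow> j < d \<Longrightarrow> P t i j \<le> 1"
  using member_le_sum[of i "{..<d}" "\<lambda>i. P t i j"] kpow_column_sum[of j t]
  by (auto simp: kpow_nonneg)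

text \<open>Nonnegative entries and column sums 1 make every power nonexpansive in the l1
  norm.\<close>

lemma kpow_contracts:
  "(\<Sum>i<d. \<bar>\<Sum>l<d. P t i l * x l\<bar>) \<le> (\<Sum>l<d. \<bar>x l\<bar>)"
proof -
  have "(\<Sum>i<d. \<bar>\<Sum>l<d. P t i l * x l\<bar>) \<le> (\<Sum>i<d. \<Sum>l<d. P t i l * \<bar>x l\<bar>)"
    by (intro sum_mono order_trans[OF sum_abs]) (simp add: abs_mult kpow_nonneg)
  also have "\<dots> = (\<Sum>l<d. \<Sum>i<d. P t i l * \<bar>x l\<bar>)"
    by (rule sum.swap)
  also have "\<dots> = (\<Sum>l<d. \<bar>x l\<bar>)"
    by (simp add: sum_distrib_right[symmetric] kpow_column_sum)
  finally show ?thesis .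
qed

lemma lag_dist_nonneg: "0 \<le> lag_dist d A D t j"
  by (simp add: lag_dist_def sum_nonneg)

text \<open>The extra steps act on the left: they apply a further power to the difference of the two
  columns, which \<open>kpow_contracts\<close> controls.\<close>

lemma lag_dist_antimono:
  assumes "s \<le> t" "j < d"
  shows "lag_dist d A D t j \<le> lag_dist d A D s j"
proof -
  obtain u where t: "t = u + s" using assms(1) by (metis add.commute le_Suc_ex)
  have "lag_dist d A D t j = (\<Sum>i<d. \<bar>\<Sum>l<d. P u i l * (P s l j - P (s + D) l j)\<bar>)"
    unfolding lag_dist_def t
    by (rule sum.cong)
      (auto simp: kpow_add assms add.assoc right_diff_distrib sum_subtractf simp del: kpow.simps)
  then show ?thesis
    using kpow_contracts[of u "\<lambda>l. P s l j - P (s + D) l j"] by (simp add: lag_dist_def)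
qed

lemma kpow_lag_mixture:
  assumes y: "\<And>l. l < d \<Longrightarrow> 0 \<le> y l"
  shows "(\<Sum>i<d. \<bar>\<Sum>l<d. (P t i l - P (t + D) i l) * y l\<bar>) \<le> (\<Sum>l<d. lag_dist d A D t l * y l)"
proof -
  have "(\<Sum>i<d. \<bar>\<Sum>l<d. (P t i l - P (t + D) i l) * y l\<bar>)
      \<le> (\<Sum>i<d. \<Sum>l<d. \<bar>P t i l - P (t + D) i l\<bar> * y l)"
    by (intro sum_mono order_trans[OF sum_abs]) (simp add: abs_mult y)
  also have "\<dots> = (\<Sum>l<d. \<Sum>i<d. \<bar>P t i l - P (t + D) i l\<bar> * y l)"
    by (rule sum.swap)
  finally show ?thesis by (simp add: lag_dist_def sum_distrib_right)
qed

text \<open>Here the extra steps act on the right: the column at time \<open>t + s\<close> is a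
  mixture of columns at time \<open>t\<close>, weighted by the law after \<open>s\<close> steps. In
  the limit this yields a maximum principle.\<close>

lemma lag_dist_subharmonic:
  assumes "j < d"
  shows "lag_dist d A D (t + s) j \<le> (\<Sum>l<d. lag_dist d A D t l * P s l j)"
proof -
  have "lag_dist d A D (t + s) j = (\<Sum>i<d. \<bar>\<Sum>l<d. (P t i l - P (t + D) i l) * P s l j\<bar>)"
    unfolding lag_dist_def
  proof (intro sum.cong refl arg_cong[where f = abs])
    fix i assume "i \<in> {..<d}"
    moreover have "t + s + D = (t + D) + s" by simp
    ultimately show "P (t + s) i j - P (t + s + D) i j = (\<Sum>l<d. (P t i l - P (t + D) i l) * P s l j)"
      by (simp only: kpow_add assms lessThan_iff left_diff_distrib sum_subtractf)
  qed
  then show ?thesis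
    using kpow_lag_mixture[of "\<lambda>l. P s l j" t D] by (simp add: kpow_nonneg assms)
qed

section \<open>The transition graph and its cycles\<close>

text \<open>Kernels are column stochastic, so an edge runs from the column index to the row index,
  in the direction of time.\<close>

definition step_rel :: "nat \<Rightarrow> (nat \<times> nat) set" where
  "step_rel s = {(j, i). j < d \<and> i < d \<and> 0 < P s i j}"

lemma kpow_pos_trans:
  assumes "i < d" "l < d" "j < d" "0 < P s i l" "0 < P t l j"
  shows "0 < P (s + t) i j"
proof -
  have "P s i l * P t l j \<le> (\<Sum>l<d. P s i l * P t l j)"
    by (rule member_le_sum[of l "{..<d}" "\<lambda>l. P s i l * P t l j"]) (use assms in \<open>auto simp: kpow_nonneg\<close>)
  moreover have "0 < P s i l * P t l j" using assms by simp
  ultimately show ?thesis unfolding kpow_add[OF assms(1,3)] by linarith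
qed

text \<open>Together with \<open>kpow_pos_imp_relpow\<close> this identifies positive entries of
  powers with walks in the graph.\<close>

lemma relpow_step_rel:
  assumes "(j, i) \<in> step_rel s ^^ n" "j < d"
  shows "i < d \<and> 0 < P (s * n) i j"
  using assms(1)
proof (induction n arbitrary: i)
  case 0
  then show ?case using assms(2) by simp
next
  case (Suc n)
  then obtain l where l: "(j, l) \<in> step_rel s ^^ n" "(l, i) \<in> step_rel s"
    by auto
  then show ?case
    using Suc.IH[OF l(1)] kpow_pos_trans[of i l j s "s * n"] assms(2) by (auto simp: step_rel_def)
qed

lemma kpow_pos_imp_relpow:
  assumes "0 < P (s * n) i j" "i < d" "j < d"
  shows "(j, i) \<in> step_rel s ^^ n"
  using assms(1,2)
proof (induction n arbitrary: i)
  case 0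
  then show ?case by (simp split: if_splits)
next
  case (Suc n)
  have "\<exists>l<d. P s i l * P (s * n) l j > 0"
  proof (rule ccontr)
    assume "\<not> ?thesis"
    then have "(\<Sum>l<d. P s i l * P (s * n) l j) \<le> 0"
      by (intro sum_nonpos) (meson lessThan_iff not_less)
    then show False
      using Suc.prems kpow_add[of i d j A s "s * n"] assms(3) by simp
  qed
  then obtain l where l: "l < d" "P s i l * P (s * n) l j > 0" by blast
  then have "0 < P s i l" "0 < P (s * n) l j"
    using kpow_nonneg[of i l s] kpow_nonneg[of l j "s * n"] Suc.prems assms(3)
    by (auto simp: zero_less_mult_iff)
  then have "(j, l) \<in> step_rel s ^^ n" "(l, i) \<in> step_rel s"
    using Suc l by (auto simp: step_rel_def)
  then show ?case by auto
qed

text \<open>A shortest closed walk through \<open>r\<close> visits pairwise distinct states, of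
  which there are only \<open>d\<close>.\<close>

lemma short_cycle:
  assumes "0 < P n r r" "0 < n" "r < d"
  shows "\<exists>m. 0 < m \<and> m \<le> d \<and> 0 < P m r r"
proof -
  define E where "E = step_rel 1"
  define m where "m = (LEAST m. 0 < m \<and> (r, r) \<in> E ^^ m)"
  have "0 < n \<and> (r, r) \<in> E ^^ n"
    using kpow_pos_imp_relpow[of 1 n r r] assms by (simp add: E_def)
  then have m: "0 < m" "(r, r) \<in> E ^^ m"
    unfolding m_def by (metis (mono_tags, lifting) LeastI)+
  have min: "m \<le> m'" if "0 < m'" "(r, r) \<in> E ^^ m'" for m'
    unfolding m_def using that by (intro Least_le) auto
  obtain f where f: "f 0 = r" "f m = r" "\<And>i. i < m \<Longrightarrow> (f i, f (Suc i)) \<in> E"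
    using m(2) unfolding relpow_fun_conv by blast
  have walk: "(f a, f (a + b)) \<in> E ^^ b" if "a + b \<le> m" for a b
    unfolding relpow_fun_conv by (rule exI[of _ "\<lambda>i. f (a + i)"]) (use that f(3) in auto)
  have "inj_on f {..<m}"
  proof (rule linorder_inj_onI)
    fix a b assume ab: "a < b" "a \<in> {..<m}" "b \<in> {..<m}"
    show "f a \<noteq> f b"
    proof
      assume "f a = f b"
      \<comment> \<open>Cutting out the segment between the two visits leaves a shorter closed walk
        through \<open>r\<close>, which is nonempty because \<open>b < m\<close>.\<close>
      then have "(r, r) \<in> E ^^ (a + (m - b))"
        using walk[of 0 a] walk[of b "m - b"] ab f unfolding relpow_add by auto
      then show False using min[of "a + (m - b)"] ab by auto
    qed
  qed auto
  moreover have "f ` {..<m} \<subseteq> {..<d}"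
    using f(3) by (auto simp: E_def step_rel_def)
  ultimately have "m \<le> d" using card_inj_on_le[of f "{..<m}" "{..<d}"] by simp
  moreover have "0 < P m r r"
    using relpow_step_rel[where s = 1 and n = m and i = r and j = r] m(2) assms(3) by (simp add: E_def)
  ultimately show ?thesis using m(1) by blast
qed

lemma kpow_diag_pos_mult:
  assumes "0 < P m r r" "r < d"
  shows "0 < P (m * c) r r"
  using assms by (induction c) (auto intro: kpow_pos_trans simp del: kpow.simps(2))

section \<open>Convergence of the lag distance for a single kernel\<close>

text \<open>Subtracting the constant \<open>\<beta>\<close> from row \<open>r\<close> does not
  change the product with a vector of sum zero. On the support of \<open>x\<close> the entries stay
  nonnegative, while the column sums drop to \<open>1 - \<beta>\<close>.\<close>

lemma doeblin_contraction:
  assumes supp: "\<And>l. l < d \<Longrightarrow> x l \<noteq> 0 \<Longrightarrow> \<beta> \<le> P t r l"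
    and zero: "(\<Sum>l<d. x l) = 0" and r: "r < d"
  shows "(\<Sum>i<d. \<bar>\<Sum>l<d. P t i l * x l\<bar>) \<le> (1 - \<beta>) * (\<Sum>l<d. \<bar>x l\<bar>)"
proof -
  define Q where "Q i l = P t i l - (if i = r then \<beta> else 0)" for i l
  have eq: "(\<Sum>l<d. P t i l * x l) = (\<Sum>l<d. Q i l * x l)" for i
    using zero by (simp add: Q_def left_diff_distrib sum_subtractf sum_distrib_left[symmetric])
  have "\<bar>Q i l * x l\<bar> = Q i l * \<bar>x l\<bar>" if "i < d" "l < d" for i l
    using that supp[of l] kpow_nonneg[of i l t] by (cases "x l = 0") (auto simp: Q_def abs_mult)
  then have "(\<Sum>i<d. \<bar>\<Sum>l<d. Q i l * x l\<bar>) \<le> (\<Sum>i<d. \<Sum>l<d. Q i l * \<bar>x l\<bar>)"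
    by (intro sum_mono order_trans[OF sum_abs]) simp
  also have "\<dots> = (\<Sum>l<d. \<Sum>i<d. Q i l * \<bar>x l\<bar>)"
    by (rule sum.swap)
  also have "\<dots> = (\<Sum>l<d. (1 - \<beta>) * \<bar>x l\<bar>)"
    using r by (intro sum.cong)
      (auto simp: sum_distrib_right[symmetric] Q_def sum_subtractf kpow_column_sum)
  finally show ?thesis by (simp add: eq sum_distrib_left)
qed

text \<open>At multiples of \<open>D\<close> the chain from \<open>r\<close> stays in the closed
  class of \<open>r\<close>. The loop at \<open>r\<close> removes periodicity, so some power has
  positive entries in row \<open>r\<close> on the whole class, and Doeblin contraction gives
  geometric decay.\<close>

lemma lag_dist_limit_nonpos_if_recurrent:
  assumes r: "r < d"
    and loop: "0 < P D r r" and D: "0 < D"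
    and returns: "\<And>i. (r, i) \<in> (step_rel D)\<^sup>* \<Longrightarrow> (i, r) \<in> (step_rel D)\<^sup>*"
    and lim: "(\<lambda>t. lag_dist d A D t r) \<longlonglongrightarrow> a"
  shows "a \<le> 0"
proof -
  define R where "R = (step_rel D)\<^sup>* `` {r}"
  have R: "i < d" if "i \<in> R" for i
    using that r unfolding R_def by (auto elim: rtranclE simp: step_rel_def)
  have finR: "finite R" and rR: "r \<in> R"
    using R finite_subset[of R "{..<d}"] by (auto simp: R_def)
  have "\<exists>n. (i, r) \<in> step_rel D ^^ n" if "i \<in> R" for i
    using returns[of i] that by (auto simp: R_def dest: rtrancl_imp_relpow)
  then obtain len where len: "(i, r) \<in> step_rel D ^^ len i" if "i \<in> R" for i
    by metis
  \<comment> \<open>\<open>N\<close> bounds all return lengths at once; the loop at \<open>r\<close>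
    fills up the remaining steps. The \<open>Suc\<close> keeps \<open>W\<close> positive, so that
    the times \<open>W * c\<close> form a subsequence.\<close>
  define N where "N = Suc (\<Sum>i\<in>R. len i)"
  define W where "W = D * N"
  have pos: "0 < P W r i" if i: "i \<in> R" for i
  proof -
    have "len i \<le> N"
      using member_le_sum[of i R len] i finR by (simp add: N_def)
    then have "W = D * (N - len i) + D * len i"
      by (simp add: W_def add_mult_distrib2[symmetric])
    moreover have "0 < P (D * len i) r i" "i < d"
      using relpow_step_rel[OF len[OF i] R[OF i]] R[OF i] by auto
    ultimately show ?thesis
      using kpow_pos_trans[of r r i "D * (N - len i)" "D * len i"]
        kpow_diag_pos_mult[OF loop r, of "N - len i"] r by simp
  qed
  define \<beta> where "\<beta> = Min ((\<lambda>i. P W r i) ` R)"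
  have \<beta>_le: "\<beta> \<le> P W r i" if "i \<in> R" for i
    using that finR by (simp add: \<beta>_def)
  have \<beta>_pos: "0 < \<beta>"
    unfolding \<beta>_def using finR rR pos by (subst Min_gr_iff) auto
  have \<beta>_le1: "\<beta> \<le> 1"
    using \<beta>_le[OF rR] kpow_le_1[OF r r, of W] by simp
  have supp: "l \<in> R" if "P (D * c) l r \<noteq> 0" "l < d" for l c
  proof -
    have "0 < P (D * c) l r" using kpow_nonneg[of l r "D * c"] that r by simp
    then have "(r, l) \<in> step_rel D ^^ c"
      using kpow_pos_imp_relpow that r by blast
    then show ?thesis by (auto simp: R_def intro: relpow_imp_rtrancl)
  qed
  have step: "lag_dist d A D (W * Suc c) r \<le> (1 - \<beta>) * lag_dist d A D (W * c) r" for c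
  proof -
    define x where "x l = P (W * c) l r - P (W * c + D) l r" for l
    have "lag_dist d A D (W * Suc c) r = (\<Sum>i<d. \<bar>\<Sum>l<d. P W i l * x l\<bar>)"
      unfolding lag_dist_def
    proof (intro sum.cong refl arg_cong[where f = abs])
      fix i assume "i \<in> {..<d}"
      then have i: "i < d" by simp
      have "W * Suc c = W + W * c" "W * Suc c + D = W + (W * c + D)" by auto
      then show "P (W * Suc c) i r - P (W * Suc c + D) i r = (\<Sum>l<d. P W i l * x l)"
        by (simp only: kpow_add[OF i r] x_def right_diff_distrib sum_subtractf)
    qed
    also have "\<dots> \<le> (1 - \<beta>) * (\<Sum>l<d. \<bar>x l\<bar>)"
    proof (rule doeblin_contraction[OF _ _ r])
      fix l assume l: "l < d" "x l \<noteq> 0"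
      \<comment> \<open>Both times are multiples of \<open>D\<close>, so both columns are supported
        in \<open>R\<close>.\<close>
      have "W * c = D * (N * c)" "W * c + D = D * (N * c + 1)"
        by (auto simp: W_def)
      then have "l \<in> R"
        using supp[of "N * c" l] supp[of "N * c + 1" l] l unfolding x_def by (metis diff_self)
      then show "\<beta> \<le> P W r l" by (rule \<beta>_le)
    qed (simp add: x_def sum_subtractf kpow_column_sum r)
    finally show ?thesis by (simp add: lag_dist_def x_def)
  qed
  have bound: "lag_dist d A D (W * c) r \<le> (1 - \<beta>) ^ c * lag_dist d A D 0 r" for c
  proof (induction c)
    case (Suc c)
    have "lag_dist d A D (W * Suc c) r \<le> (1 - \<beta>) * lag_dist d A D (W * c) r"
      by (rule step)
    also have "\<dots> \<le> (1 - \<beta>) * ((1 - \<beta>) ^ c * lag_dist d A D 0 r)"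
      by (rule mult_left_mono[OF Suc]) (use \<beta>_le1 in simp)
    finally show ?case by (simp add: mult.assoc)
  qed simp
  have "strict_mono (\<lambda>c. W * c)"
    using D by (simp add: strict_mono_def W_def N_def)
  then have "(\<lambda>c. lag_dist d A D (W * c) r) \<longlonglongrightarrow> a"
    using LIMSEQ_subseq_LIMSEQ[OF lim] by (simp add: o_def)
  moreover have "(\<lambda>c. (1 - \<beta>) ^ c * lag_dist d A D 0 r) \<longlonglongrightarrow> 0 * lag_dist d A D 0 r"
    by (intro tendsto_intros LIMSEQ_power_zero) (use \<beta>_pos \<beta>_le1 in simp)
  ultimately have "a \<le> 0 * lag_dist d A D 0 r"
    by (rule LIMSEQ_le) (use bound in blast)
  then show ?thesis by simp
qed

text \<open>Monotonicity gives a limit for each state, and a maximum principle reduces the claim to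
  one recurrent state. The divisibility hypothesis supplies the loop of length \<open>D\<close>
  there.\<close>

lemma lag_dist_tendsto_0:
  assumes dvd: "\<And>m. 0 < m \<Longrightarrow> m \<le> d \<Longrightarrow> m dvd D" and D: "0 < D" and j: "j < d"
  shows "(\<lambda>t. lag_dist d A D t j) \<longlonglongrightarrow> 0"
proof -
  have "\<exists>a. (\<lambda>t. lag_dist d A D t j) \<longlonglongrightarrow> a" if "j < d" for j
    using decseq_convergent[of "\<lambda>t. lag_dist d A D t j" 0] that
    by (metis decseq_def lag_dist_antimono lag_dist_nonneg)
  then obtain L where L: "(\<lambda>t. lag_dist d A D t j) \<longlonglongrightarrow> L j" if "j < d" for j
    by metis
  have L_sub: "L j \<le> (\<Sum>l<d. L l * P s l j)" if "j < d" for j s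
  proof (rule LIMSEQ_le)
    show "(\<lambda>t. lag_dist d A D (t + s) j) \<longlonglongrightarrow> L j"
      using L[OF that] by (rule LIMSEQ_ignore_initial_segment)
    show "(\<lambda>t. \<Sum>l<d. lag_dist d A D t l * P s l j) \<longlonglongrightarrow> (\<Sum>l<d. L l * P s l j)"
      by (intro tendsto_intros L) auto
  qed (use lag_dist_subharmonic that in blast)
  \<comment> \<open>The limit \<open>L\<close> is subharmonic, so the states where it attains its maximum form a closed set;
    the state \<open>r\<close> below is a recurrent one among them.\<close>
  define M where "M = Max (L ` {..<d})"
  have L_le: "L i \<le> M" if "i < d" for i
    using that by (simp add: M_def)
  have "M \<in> L ` {..<d}"
    unfolding M_def using j by (intro Max_in) auto
  then obtain j0 where j0: "j0 < d" "L j0 = M" by auto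
  define G where "G = step_rel D"
  have closed1: "L i = M" if "(l, i) \<in> G" "L l = M" for l i
  proof (rule ccontr)
    assume "L i \<noteq> M"
    have li: "l < d" "i < d" "0 < P D i l"
      using that by (auto simp: G_def step_rel_def)
    then have "L i < M" using L_le[of i] \<open>L i \<noteq> M\<close> by simp
    then have "(\<Sum>m<d. L m * P D m l) < (\<Sum>m<d. M * P D m l)"
      using li L_le
      by (intro sum_strict_mono_ex1) (auto intro!: mult_right_mono kpow_nonneg bexI[of _ i])
    also have "\<dots> = M" using li by (simp add: sum_distrib_left[symmetric] kpow_column_sum)
    finally show False using L_sub[of l D] li that by simp
  qed
  have closed: "i < d \<and> L i = M" if "(l, i) \<in> G\<^sup>*" "l < d" "L l = M" for l i
    using that(1) by (induction) (use that closed1 in \<open>auto simp: G_def step_rel_def\<close>)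
  \<comment> \<open>Minimality of the reachable set forces recurrence: a state reachable from
    \<open>r\<close> reaches no more than \<open>r\<close> does, hence exactly the same states,
    including \<open>r\<close>.\<close>
  obtain r where r: "r < d" "L r = M"
    and min: "\<And>i. i < d \<Longrightarrow> L i = M \<Longrightarrow> card (G\<^sup>* `` {r}) \<le> card (G\<^sup>* `` {i})"
    using ex_has_least_nat[of "\<lambda>i. i < d \<and> L i = M" j0 "\<lambda>i. card (G\<^sup>* `` {i})"] j0 by auto
  have returns: "(i, r) \<in> G\<^sup>*" if "(r, i) \<in> G\<^sup>*" for i
  proof -
    have "G\<^sup>* `` {r} \<subseteq> {..<d}" using closed r by auto
    then have "finite (G\<^sup>* `` {r})" by (rule finite_subset) simp
    moreover have "G\<^sup>* `` {i} \<subseteq> G\<^sup>* `` {r}" using that by (auto intro: rtrancl_trans)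
    ultimately have "G\<^sup>* `` {i} = G\<^sup>* `` {r}"
      using min[of i] closed[OF that r] by (intro card_seteq) auto
    then show ?thesis by auto
  qed
  have "\<exists>l<d. P D l r \<noteq> 0"
  proof (rule ccontr)
    assume "\<not> ?thesis"
    then have "(\<Sum>l<d. P D l r) = 0" by simp
    then show False using kpow_column_sum[OF r(1), of D] by simp
  qed
  then obtain l where "(r, l) \<in> G"
    using kpow_nonneg[of _ r D] r by (force simp: G_def step_rel_def less_le)
  moreover from this obtain n where "(l, r) \<in> G ^^ n"
    using returns rtrancl_imp_relpow by (meson r_into_rtrancl)
  ultimately have "(r, r) \<in> G ^^ Suc n"
    by (meson relpow_Suc_I2)
  then have "0 < P (D * Suc n) r r"
    using relpow_step_rel[where s = D and n = "Suc n" and i = r and j = r] r by (simp add: G_def)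
  \<comment> \<open>The closed walk may be long, but it can be replaced by one of length at most
    \<open>d\<close>; that length divides \<open>D\<close>, so repeating it gives a loop of exactly
    \<open>D\<close> steps.\<close>
  then obtain m where "0 < m" "m \<le> d" "0 < P m r r"
    using short_cycle[of "D * Suc n" r] D r by auto
  then have "0 < P D r r"
    using dvd kpow_diag_pos_mult[of m r] r by (metis dvdE)
  then have "M \<le> 0"
    using lag_dist_limit_nonpos_if_recurrent[OF r(1) _ D _ L[OF r(1)]] returns r by (simp add: G_def)
  moreover have "0 \<le> L j"
    using LIMSEQ_le_const[OF L[OF j]] lag_dist_nonneg by blast
  ultimately have "L j = 0" using L_le[OF j] by simp
  then show ?thesis using L[OF j] by simp
qed

lemma lag_mixture_le:
  assumes "\<And>l. l < d \<Longrightarrow> 0 \<le> y l" "(\<Sum>l<d. y l) = 1" "\<And>l. l < d \<Longrightarrow> lag_dist d A D t l \<le> \<delta>"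
  shows "(\<Sum>i<d. \<bar>\<Sum>l<d. (P t i l - P (t + D) i l) * y l\<bar>) \<le> \<delta>"
proof -
  have "(\<Sum>l<d. lag_dist d A D t l * y l) \<le> (\<Sum>l<d. \<delta> * y l)"
    by (intro sum_mono mult_right_mono) (use assms in auto)
  then show ?thesis
    using kpow_lag_mixture[of y t D] assms by (simp add: sum_distrib_left[symmetric])
qed

end

section \<open>Uniformity over all kernels by compactness\<close>

lemma kpow_tendsto:
  assumes "\<And>i j. i < d \<Longrightarrow> j < d \<Longrightarrow> (\<lambda>n. A n i j) \<longlonglongrightarrow> B i j" "i < d" "j < d"
  shows "(\<lambda>n. kpow d (A n) t i j) \<longlonglongrightarrow> kpow d B t i j"
  using assms(2)
  by (induction t arbitrary: i) (auto intro!: tendsto_intros assms(1,3))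

text \<open>Bolzano-Weierstrass for finitely many coordinates: the subsequence is refined one
  coordinate at a time, each time to a bounded monotone sequence.\<close>

lemma finite_family_convergent_subseq:
  fixes f :: "'i \<Rightarrow> nat \<Rightarrow> real"
  assumes "finite I" "\<And>i. i \<in> I \<Longrightarrow> Bseq (f i)"
  shows "\<exists>\<sigma>. strict_mono (\<sigma> :: nat \<Rightarrow> nat) \<and> (\<forall>i\<in>I. convergent (f i \<circ> \<sigma>))"
  using assms
proof (induction I rule: finite_induct)
  case empty
  show ?case using strict_mono_id by blast
next
  case (insert i I)
  then obtain \<sigma> where \<sigma>: "strict_mono \<sigma>" "\<forall>i\<in>I. convergent (f i \<circ> \<sigma>)"
    by (meson insertI2)
  obtain \<tau> where \<tau>: "strict_mono \<tau>" "monoseq (\<lambda>n. (f i \<circ> \<sigma>) (\<tau> n))"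
    using seq_monosub[of "f i \<circ> \<sigma>"] by blast
  have "Bseq (\<lambda>n. (f i \<circ> \<sigma>) (\<tau> n))"
    using insert.prems[of i] Bseq_subseq[of "f i" "\<sigma> \<circ> \<tau>"] by (simp add: o_def)
  then have "convergent (f i \<circ> (\<sigma> \<circ> \<tau>))"
    using Bseq_monoseq_convergent \<tau>(2) by (simp add: o_def)
  moreover have "convergent (f l \<circ> (\<sigma> \<circ> \<tau>))" if "l \<in> I" for l
    using convergent_subseq_convergent[OF _ \<tau>(1)] \<sigma>(2) that by (metis comp_assoc)
  ultimately show ?case using strict_mono_o[OF \<sigma>(1) \<tau>(1)] by blast
qed

text \<open>Counterexamples at ever later times would have a subsequence converging to a kernel
  \<open>B\<close>. The lag distance of \<open>B\<close> is small at some fixed time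
  \<open>t0\<close>, by continuity so is that of nearby kernels, and monotonicity keeps it small
  afterwards.\<close>

lemma lag_dist_uniform:
  assumes dvd: "\<And>m. 0 < m \<Longrightarrow> m \<le> d \<Longrightarrow> m dvd D" and D: "0 < D" and \<delta>: "0 < \<delta>"
  shows "\<exists>T. \<forall>A. stochastic_kernel d A \<longrightarrow> (\<forall>t\<ge>T. \<forall>j<d. lag_dist d A D t j < \<delta>)"
proof (rule ccontr)
  assume "\<not> ?thesis"
  then have "\<exists>A. stochastic_kernel d A \<and> (\<exists>t\<ge>T. \<exists>j<d. \<delta> \<le> lag_dist d A D t j)" for T
    by (meson not_less)
  then obtain A where A: "stochastic_kernel d (A T)"
    and large: "\<exists>t\<ge>T. \<exists>j<d. \<delta> \<le> lag_dist d (A T) D t j" for T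
    by metis
  have "Bseq (\<lambda>T. A T i j)" if "i < d" "j < d" for i j
  proof (rule BseqI'[of _ 1])
    fix T
    interpret stochastic_kernel d "A T" by (rule A)
    show "norm (A T i j) \<le> 1"
      using nonneg[OF that] kpow_le_1[OF that, of "Suc 0"] kpow_1[OF that] by simp
  qed
  then obtain \<sigma> :: "nat \<Rightarrow> nat" where \<sigma>: "strict_mono \<sigma>"
    and conv: "\<forall>(i, j)\<in>{..<d} \<times> {..<d}. convergent (\<lambda>n. A (\<sigma> n) i j)"
    using finite_family_convergent_subseq[of "{..<d} \<times> {..<d}" "\<lambda>(i, j) T. A T i j"]
    by (auto simp: o_def case_prod_unfold)
  define B where "B i j = lim (\<lambda>n. A (\<sigma> n) i j)" for i j
  have B: "(\<lambda>n. A (\<sigma> n) i j) \<longlonglongrightarrow> B i j" if "i < d" "j < d" for i j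
    using conv that by (auto simp: B_def convergent_LIMSEQ_iff)
  interpret B: stochastic_kernel d B
  proof
    show "0 \<le> B i j" if "i < d" "j < d" for i j
      using LIMSEQ_le_const[OF B[OF that]] stochastic_kernel.nonneg[OF A that] by blast
    show "(\<Sum>i<d. B i j) = 1" if "j < d" for j
    proof (rule LIMSEQ_unique)
      show "(\<lambda>n. \<Sum>i<d. A (\<sigma> n) i j) \<longlonglongrightarrow> (\<Sum>i<d. B i j)"
        by (intro tendsto_intros B) (use that in auto)
      show "(\<lambda>n. \<Sum>i<d. A (\<sigma> n) i j) \<longlonglongrightarrow> 1"
        by (simp add: stochastic_kernel.column_sum[OF A that])
    qed
  qed
  have "\<forall>\<^sub>F t in sequentially. \<forall>j\<in>{..<d}. lag_dist d B D t j < \<delta>"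
    by (intro eventually_ball_finite ballI order_tendstoD(2)[OF B.lag_dist_tendsto_0 \<delta>])
      (use dvd D in auto)
  then obtain t0 where t0: "\<And>j. j < d \<Longrightarrow> lag_dist d B D t0 j < \<delta>"
    by (auto simp: eventually_sequentially)
  have "(\<lambda>n. lag_dist d (A (\<sigma> n)) D t0 j) \<longlonglongrightarrow> lag_dist d B D t0 j" if "j < d" for j
    unfolding lag_dist_def using that by (intro tendsto_intros kpow_tendsto B) auto
  then have "\<forall>\<^sub>F n in sequentially. \<forall>j\<in>{..<d}. lag_dist d (A (\<sigma> n)) D t0 j < \<delta>"
    using t0 by (intro eventually_ball_finite ballI) (auto dest: order_tendstoD(2))
  then obtain n0 where n0: "\<And>n j. n0 \<le> n \<Longrightarrow> j < d \<Longrightarrow> lag_dist d (A (\<sigma> n)) D t0 j < \<delta>"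
    by (auto simp: eventually_sequentially)
  \<comment> \<open>\<open>n0\<close> makes the kernel close enough to \<open>B\<close>;
    \<open>t0\<close> ensures that the bad time, which is at least \<open>\<sigma> n\<close>, is not
    before \<open>t0\<close>.\<close>
  define n where "n = max n0 t0"
  have "t0 \<le> \<sigma> n" using seq_suble[OF \<sigma>, of n] by (simp add: n_def)
  moreover obtain t j where "\<sigma> n \<le> t" "j < d" "\<delta> \<le> lag_dist d (A (\<sigma> n)) D t j"
    using large by blast
  ultimately show False
    using stochastic_kernel.lag_dist_antimono[OF A, of t0 t j "\<sigma> n" D] n0[of n j] by (simp add: n_def)
qed

section \<open>Runs of the OBDD on ones followed by zeros\<close>

lemma stochastic_kernel_mat:
  "column_stochastic d M \<Longrightarrow> stochastic_kernel d (\<lambda>i j. M $$ (i, j))"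
  by (simp add: column_stochastic_def stochastic_kernel_def)

text \<open>Turns a stretch of levels with the same matrix into a power, passing from
  \<open>real mat\<close> to index functions.\<close>

lemma state_constant_segment:
  assumes M: "M \<in> carrier_mat d d"
    and seg: "\<And>j. m \<le> j \<Longrightarrow> j < m + t \<Longrightarrow> trans P j (\<nu> ! perm P j) = M"
    and start: "state P \<nu> m \<in> carrier_vec d"
  shows "state P \<nu> (m + t) \<in> carrier_vec d \<and>
    (\<forall>i<d. state P \<nu> (m + t) $ i =
      (\<Sum>l<d. kpow d (\<lambda>i j. M $$ (i, j)) t i l * state P \<nu> m $ l))"
  using seg
proof (induction t)
  case 0
  have "(\<Sum>l<d. of_bool (i = l) * state P \<nu> m $ l) = state P \<nu> m $ i" if "i < d" for i
  proof -
    have "(\<Sum>l<d. of_bool (i = l) * state P \<nu> m $ l) =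
        (\<Sum>l<d. if i = l then state P \<nu> m $ l else 0)"
      by (rule sum.cong) auto
    then show ?thesis using that by simp
  qed
  then show ?case using start by simp
next
  case (Suc t)
  let ?K = "kpow d (\<lambda>i j. M $$ (i, j)) t"
  have IH: "state P \<nu> (m + t) \<in> carrier_vec d"
    "\<And>i. i < d \<Longrightarrow> state P \<nu> (m + t) $ i = (\<Sum>l<d. ?K i l * state P \<nu> m $ l)"
    using Suc by auto
  have step: "state P \<nu> (m + Suc t) = M *\<^sub>v state P \<nu> (m + t)"
    using Suc.prems[of "m + t"] by simp
  have "state P \<nu> (m + Suc t) $ i =
      (\<Sum>l<d. kpow d (\<lambda>i j. M $$ (i, j)) (Suc t) i l * state P \<nu> m $ l)" if i: "i < d" for i
  proof -
    have "state P \<nu> (m + Suc t) $ i = (\<Sum>j<d. M $$ (i, j) * state P \<nu> (m + t) $ j)"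
      unfolding step using M IH(1) i by (auto simp: scalar_prod_def lessThan_atLeast0 intro!: sum.cong)
    also have "\<dots> = (\<Sum>j<d. \<Sum>l<d. M $$ (i, j) * ?K j l * state P \<nu> m $ l)"
      by (simp add: IH(2) sum_distrib_left mult.assoc)
    also have "\<dots> = (\<Sum>l<d. \<Sum>j<d. M $$ (i, j) * ?K j l * state P \<nu> m $ l)"
      by (rule sum.swap)
    finally show ?thesis by (simp add: sum_distrib_right)
  qed
  moreover have "state P \<nu> (m + Suc t) \<in> carrier_vec d"
    unfolding step using M IH(1) by (rule mult_mat_vec_carrier)
  ultimately show ?case by blast
qed

text \<open>Variable \<open>i\<close> is read at level \<open>inv_into UNIV \<pi> i\<close>, so the
  ones are placed first in reading order, not in order of the variables.\<close>

definition ones_first :: "nat \<Rightarrow> (nat \<Rightarrow> nat) \<Rightarrow> nat \<Rightarrow> bool list" where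
  "ones_first n \<pi> m = map (\<lambda>i. inv_into UNIV \<pi> i < m) [0..<n]"

lemma length_ones_first [simp]: "length (ones_first n \<pi> m) = n"
  by (simp add: ones_first_def)

lemma ones_first_nth:
  assumes "\<pi> permutes {..<n}" "j < n"
  shows "ones_first n \<pi> m ! \<pi> j \<longleftrightarrow> j < m"
  using assms permutes_in_image[OF assms(1), of j]
  by (simp add: ones_first_def permutes_inverses(2)[OF assms(1)])

lemma num_ones_ones_first:
  assumes "\<pi> permutes {..<n}" "m \<le> n"
  shows "num_ones (ones_first n \<pi> m) = m"
proof -
  have "{i. i < n \<and> ones_first n \<pi> m ! i} = \<pi> ` {..<m}"
  proof (intro equalityI subsetI)
    fix i assume i: "i \<in> {i. i < n \<and> ones_first n \<pi> m ! i}"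
    then obtain j where "j < n" "i = \<pi> j"
      using permutes_image[OF assms(1)] by (metis (no_types, lifting) imageE lessThan_iff mem_Collect_eq)
    then show "i \<in> \<pi> ` {..<m}" using i ones_first_nth[OF assms(1)] by auto
  next
    fix i assume "i \<in> \<pi> ` {..<m}"
    then show "i \<in> {i. i < n \<and> ones_first n \<pi> m ! i}"
      using ones_first_nth[OF assms(1)] permutes_in_image[OF assms(1)] assms(2) by auto
  qed
  then show ?thesis
    unfolding num_ones_def
    using card_image[OF inj_on_subset[OF permutes_inj[OF assms(1)] subset_UNIV], of "{..<m}"]
    by simp
qed

lemma accept_prob_ones_first:
  assumes P: "is_pobdd n d P" "stable_pobdd n P" and n: "n = m + t" "0 < n"
  shows "accept_prob P (ones_first n (perm P) m) =
    (\<Sum>i\<in>accept P. \<Sum>l<d. kpow d (\<lambda>i j. trans P 0 False $$ (i, j)) t i l *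
      (\<Sum>j<d. kpow d (\<lambda>i j. trans P 0 True $$ (i, j)) m l j * init P $ j))"
proof -
  let ?\<nu> = "ones_first n (perm P) m"
  have perm: "perm P permutes {..<n}" and acc: "accept P \<subseteq> {..<d}"
    and carrier: "trans P 0 b \<in> carrier_mat d d" and init: "init P \<in> carrier_vec d" for b
    using P n by (auto simp: is_pobdd_def column_stochastic_def stochastic_vec_def)
  have stable: "trans P j b = trans P 0 b" if "j < n" for j b
    using P(2) that n(2) unfolding stable_pobdd_def by blast
  have trans: "trans P j (?\<nu> ! perm P j) = trans P 0 (j < m)" if "j < n" for j
    using stable[OF that] ones_first_nth[OF perm that] by simp
  have "state P ?\<nu> (0 + m) \<in> carrier_vec d \<and>
      (\<forall>i<d. state P ?\<nu> (0 + m) $ i =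
        (\<Sum>l<d. kpow d (\<lambda>i j. trans P 0 True $$ (i, j)) m i l * state P ?\<nu> 0 $ l))"
    by (rule state_constant_segment[OF carrier]) (use trans n init in auto)
  moreover from this have "\<forall>i<d. state P ?\<nu> (m + t) $ i =
      (\<Sum>l<d. kpow d (\<lambda>i j. trans P 0 False $$ (i, j)) t i l * state P ?\<nu> m $ l)"
    using state_constant_segment[OF carrier[of False], of m t P ?\<nu>] trans n by simp
  ultimately show ?thesis
    using acc by (auto simp: accept_prob_def n(1)[symmetric] intro!: sum.cong)
qed

text \<open>Both final vectors are compared with the one after \<open>m\<close> ones and
  \<open>u\<close> zeros, which is \<open>D\<close> letters short of either input. Adding
  \<open>D\<close> zeros costs at most \<open>\<delta>\<close>; so does adding \<open>D\<close>
  ones, since the zeros read afterwards do not expand the difference.\<close>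

lemma accept_prob_ones_first_close:
  assumes P: "is_pobdd n d P" "stable_pobdd n P" and n: "n = m + D + u" "0 < n"
    and lag1: "\<And>j. j < d \<Longrightarrow> lag_dist d (\<lambda>i j. trans P 0 True $$ (i, j)) D m j \<le> \<delta>"
    and lag0: "\<And>j. j < d \<Longrightarrow> lag_dist d (\<lambda>i j. trans P 0 False $$ (i, j)) D u j \<le> \<delta>"
  shows "\<bar>accept_prob P (ones_first n (perm P) m) - accept_prob P (ones_first n (perm P) (m + D))\<bar> \<le> 2 * \<delta>"
proof -
  define K1 where "K1 = kpow d (\<lambda>i j. trans P 0 True $$ (i, j))"
  define K0 where "K0 = kpow d (\<lambda>i j. trans P 0 False $$ (i, j))"
  define v where "v j = init P $ j" for j
  define y where "y t l = (\<Sum>j<d. K1 t l j * v j)" for t l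
  interpret S1: stochastic_kernel d "\<lambda>i j. trans P 0 True $$ (i, j)"
    using P n by (intro stochastic_kernel_mat) (auto simp: is_pobdd_def)
  interpret S0: stochastic_kernel d "\<lambda>i j. trans P 0 False $$ (i, j)"
    using P n by (intro stochastic_kernel_mat) (auto simp: is_pobdd_def)
  have acc: "accept P \<subseteq> {..<d}" and v: "\<And>j. j < d \<Longrightarrow> 0 \<le> v j" "(\<Sum>j<d. v j) = 1"
    using P(1) by (auto simp: is_pobdd_def stochastic_vec_def v_def)
  have y_nonneg: "0 \<le> y t l" if "l < d" for t l
    using that v S1.kpow_nonneg by (auto simp: y_def K1_def intro!: sum_nonneg)
  have y_sum: "(\<Sum>l<d. y t l) = 1" for t
  proof -
    have "(\<Sum>l<d. y t l) = (\<Sum>j<d. \<Sum>l<d. K1 t l j * v j)"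
      unfolding y_def by (rule sum.swap)
    then show ?thesis
      using v by (simp add: sum_distrib_right[symmetric] K1_def S1.kpow_column_sum)
  qed
  define a where "a i = (\<Sum>l<d. K0 (u + D) i l * y m l)" for i
  define b where "b i = (\<Sum>l<d. K0 u i l * y (m + D) l)" for i
  define c where "c i = (\<Sum>l<d. K0 u i l * y m l)" for i
  have "(\<Sum>i<d. \<bar>c i - a i\<bar>) = (\<Sum>i<d. \<bar>\<Sum>l<d. (K0 u i l - K0 (u + D) i l) * y m l\<bar>)"
    by (simp add: a_def c_def left_diff_distrib sum_subtractf)
  also have "\<dots> \<le> \<delta>"
    unfolding K0_def by (rule S0.lag_mixture_le) (use y_nonneg y_sum lag0 in auto)
  finally have ca: "(\<Sum>i<d. \<bar>c i - a i\<bar>) \<le> \<delta>" .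
  have "(\<Sum>i<d. \<bar>c i - b i\<bar>) = (\<Sum>i<d. \<bar>\<Sum>l<d. K0 u i l * (y m l - y (m + D) l)\<bar>)"
    by (simp add: b_def c_def right_diff_distrib sum_subtractf)
  also have "\<dots> \<le> (\<Sum>l<d. \<bar>y m l - y (m + D) l\<bar>)"
    unfolding K0_def by (rule S0.kpow_contracts)
  also have "\<dots> = (\<Sum>l<d. \<bar>\<Sum>j<d. (K1 m l j - K1 (m + D) l j) * v j\<bar>)"
    by (simp add: y_def left_diff_distrib sum_subtractf)
  also have "\<dots> \<le> \<delta>"
    unfolding K1_def by (rule S1.lag_mixture_le) (use v lag1 in auto)
  finally have cb: "(\<Sum>i<d. \<bar>c i - b i\<bar>) \<le> \<delta>" .
  have "accept_prob P (ones_first n (perm P) m) = (\<Sum>i\<in>accept P. a i)"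
    using accept_prob_ones_first[OF P, of m "u + D"] n by (simp add: a_def y_def K0_def K1_def v_def)
  moreover have "accept_prob P (ones_first n (perm P) (m + D)) = (\<Sum>i\<in>accept P. b i)"
    using accept_prob_ones_first[OF P, of "m + D" u] n by (simp add: b_def y_def K0_def K1_def v_def)
  ultimately have "\<bar>accept_prob P (ones_first n (perm P) m) - accept_prob P (ones_first n (perm P) (m + D))\<bar>
      = \<bar>\<Sum>i\<in>accept P. a i - b i\<bar>"
    by (simp add: sum_subtractf)
  also have "\<dots> \<le> (\<Sum>i\<in>accept P. \<bar>a i - b i\<bar>)"
    by (rule sum_abs)
  also have "\<dots> \<le> (\<Sum>i<d. \<bar>a i - b i\<bar>)"
    by (rule sum_mono2) (use acc in auto)
  also have "\<dots> \<le> (\<Sum>i<d. \<bar>c i - a i\<bar> + \<bar>c i - b i\<bar>)"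
    by (rule sum_mono) linarith
  finally show ?thesis using ca cb by (simp add: sum.distrib)
qed

section \<open>Arithmetic modulo powers of two and the width bound\<close>

lemma PartialMOD_multiple:
  assumes "length \<nu> = n" "num_ones \<nu> = 2 ^ k * c"
  shows "PartialMOD k n \<nu> = Some (even c)"
proof (cases "even c")
  case True
  then obtain e where "c = 2 * e" by blast
  then show ?thesis using assms by (simp add: PartialMOD_def cong_def mult.assoc[symmetric])
next
  case False
  then obtain e where "c = 2 * e + 1" by (auto elim: oddE)
  then have "num_ones \<nu> = 2 ^ k + 2 ^ (k + 1) * e" using assms by (simp add: algebra_simps)
  moreover have "(2::nat) ^ k < 2 ^ (k + 1)" by simp
  ultimately have "num_ones \<nu> mod 2 ^ (k + 1) = 2 ^ k" by (metis mod_less mod_mult_self2)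
  then show ?thesis using assms False by (simp add: PartialMOD_def cong_def)
qed

text \<open>Any such \<open>m\<close> is a power of two with exponent at most \<open>k\<close> times
  an odd number below \<open>2 ^ (k + 1)\<close>. The product of all these odd numbers serves as
  \<open>c\<close>.\<close>

lemma common_multiple_two_adic:
  "\<exists>c::nat. odd c \<and> (\<forall>m. 0 < m \<and> m < 2 ^ (k + 1) \<longrightarrow> m dvd 2 ^ k * c)"
proof -
  define Odds where "Odds = {i::nat. odd i \<and> i < 2 ^ (k + 1)}"
  have fin: "finite Odds" by (simp add: Odds_def)
  have "m dvd 2 ^ k * \<Prod>Odds" if m: "0 < m" "m < 2 ^ (k + 1)" for m
  proof -
    obtain q where q: "m = 2 ^ multiplicity 2 m * q" "odd q"
      using multiplicity_decompose'[of m 2] m by auto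
    have "q > 0" using q(2) by (rule odd_pos)
    have "2 ^ multiplicity 2 m \<le> m" "q \<le> m"
      using m by (auto intro!: dvd_imp_le multiplicity_dvd) (metis dvd_imp_le dvd_triv_right q(1))
    then have "(2::nat) ^ multiplicity 2 m < 2 ^ (k + 1)" "q \<in> Odds"
      using m q by (auto simp: Odds_def)
    then have "multiplicity 2 m \<le> k" "q dvd \<Prod>Odds"
      using fin power_less_imp_less_exp[of "2::nat" "multiplicity 2 m" "k + 1"]
      by (auto intro: dvd_prodI[of Odds q id, simplified])
    then have "2 ^ multiplicity 2 m * q dvd 2 ^ k * \<Prod>Odds"
      by (intro mult_dvd_mono le_imp_power_dvd)
    then show ?thesis using q(1) by simp
  qed
  moreover have "odd (\<Prod>Odds)"
    using fin by (auto simp: even_prod_iff Odds_def)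
  ultimately show ?thesis by blast
qed

theorem theorem4:
  fixes k :: nat and \<epsilon> :: real
  assumes "\<epsilon> \<in> {0<..1/2}"
  shows "infinite {n. \<forall>d P. is_pobdd n d P \<and> stable_pobdd n P \<and>
           computes_bounded_error \<epsilon> n P (PartialMOD k n) \<longrightarrow> 2 ^ (k + 1) \<le> d}"
proof -
  obtain c :: nat where c: "odd c"
    and dvd: "\<And>m. 0 < m \<Longrightarrow> m < 2 ^ (k + 1) \<Longrightarrow> m dvd 2 ^ k * c"
    using common_multiple_two_adic by blast
  define D where "D = 2 ^ k * c"
  have D: "0 < D" using odd_pos[OF c] by (simp add: D_def)
  \<comment> \<open>The two segments contribute \<open>\<epsilon> / 2\<close> each; their total
    \<open>\<epsilon>\<close> is below the gap \<open>2 * \<epsilon>\<close> between acceptance and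
    rejection.\<close>
  have "\<exists>T. \<forall>A. stochastic_kernel d A \<longrightarrow> (\<forall>t\<ge>T. \<forall>j<d. lag_dist d A D t j < \<epsilon> / 2)"
    if "d < 2 ^ (k + 1)" for d
    by (rule lag_dist_uniform) (use D dvd that assms in \<open>auto simp: D_def\<close>)
  then obtain \<tau> where \<tau>: "lag_dist d A D t j < \<epsilon> / 2"
    if "d < 2 ^ (k + 1)" "stochastic_kernel d A" "\<tau> d \<le> t" "j < d" for d A t j
    by metis
  \<comment> \<open>The sum dominates the thresholds of all widths below \<open>2 ^ (k + 1)\<close>.
    It depends on \<open>k\<close> and \<open>\<epsilon>\<close>, but not on \<open>n\<close> or the
    OBDD.\<close>
  define T where "T = (\<Sum>d<2 ^ (k + 1). \<tau> d)"
  \<comment> \<open>The input length leaves room for \<open>D * T\<close> ones, a block of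
    \<open>D\<close> letters to be flipped, and at least \<open>T\<close> zeros. Since
    \<open>D\<close> is positive, \<open>D * T\<close> is also at least \<open>T\<close>.\<close>
  have "2 ^ (k + 1) \<le> d"
    if n: "D * T + D + T \<le> n" and P: "is_pobdd n d P" "stable_pobdd n P"
      and comp: "computes_bounded_error \<epsilon> n P (PartialMOD k n)" for n d P
  proof (rule ccontr)
    assume "\<not> 2 ^ (k + 1) \<le> d"
    then have d: "d < 2 ^ (k + 1)" by simp
    then have T: "\<tau> d \<le> T" unfolding T_def by (intro member_le_sum) auto
    obtain u where u: "n = D * T + D + u" "T \<le> u"
      using n by (metis add.assoc le_Suc_ex nat_add_left_cancel_le le_add1)
    have "0 < n" using u D by simp
    have lag: "lag_dist d (\<lambda>i j. trans P 0 b $$ (i, j)) D t j \<le> \<epsilon> / 2"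
      if "T \<le> t" "j < d" for b t j
      using \<tau>[OF d stochastic_kernel_mat, of "trans P 0 b" t j] that T P \<open>0 < n\<close>
      by (simp add: is_pobdd_def)
    have "T \<le> D * T" using D by simp
    define \<nu> where "\<nu> m = ones_first n (perm P) m" for m
    have close: "\<bar>accept_prob P (\<nu> (D * T)) - accept_prob P (\<nu> (D * T + D))\<bar> \<le> 2 * (\<epsilon> / 2)"
      unfolding \<nu>_def
      by (rule accept_prob_ones_first_close[OF P u(1) \<open>0 < n\<close>]) (use lag u \<open>T \<le> D * T\<close> in auto)
    have perm: "perm P permutes {..<n}" using P by (simp add: is_pobdd_def)
    have "PartialMOD k n (\<nu> (D * T)) = Some (even (c * T))"
      unfolding \<nu>_def using u num_ones_ones_first[OF perm, of "D * T"]
      by (intro PartialMOD_multiple) (auto simp: D_def mult.assoc)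
    moreover have "PartialMOD k n (\<nu> (D * T + D)) = Some (even (c * T + c))"
      unfolding \<nu>_def using u num_ones_ones_first[OF perm, of "D * T + D"]
      by (intro PartialMOD_multiple) (auto simp: D_def algebra_simps)
    moreover have "length (\<nu> m) = n" for m by (simp add: \<nu>_def)
    \<comment> \<open>As \<open>c\<close> is odd, \<open>c * T\<close> and \<open>c * T + c\<close>
      have opposite parity, so exactly one of the two inputs must be accepted.\<close>
    ultimately have
      "even (c * T) \<Longrightarrow> 1/2 + \<epsilon> \<le> accept_prob P (\<nu> (D * T))"
      "odd (c * T) \<Longrightarrow> accept_prob P (\<nu> (D * T)) \<le> 1/2 - \<epsilon>"
      "odd (c * T) \<Longrightarrow> 1/2 + \<epsilon> \<le> accept_prob P (\<nu> (D * T + D))"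
      "even (c * T) \<Longrightarrow> accept_prob P (\<nu> (D * T + D)) \<le> 1/2 - \<epsilon>"
      using comp c unfolding computes_bounded_error_def by simp_all
    then show False using close assms by (cases "even (c * T)") auto
  qed
  then have "{D * T + D + T..} \<subseteq> {n. \<forall>d P. is_pobdd n d P \<and> stable_pobdd n P \<and>
           computes_bounded_error \<epsilon> n P (PartialMOD k n) \<longrightarrow> 2 ^ (k + 1) \<le> d}"
    by auto
  then show ?thesis using infinite_Ici infinite_super by blast
qed

end
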